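(* Let $L$ be a completely integrally closed lattice domain. Then $L$ is divisorial if and only if $L$ is Dedekind.
   Context: A multiplicative lattice is a complete lattice $(L,\le)$ with bottom element $0$ and top element $1$, which is also a commutative monoid with identity $1$, such that $a(\bigvee_\alpha b_\alpha)=\bigvee_\alpha(ab_\alpha)$ for all $a,b_\alpha\in L$. An element $c\in L$ is compact if $S\subseteq L$ and $c\le\bigvee S$ imply $c\le\bigvee T$ for some finite $T\subseteq S$. For $x,y\in L$, $(y:x)=\bigvee\{a\in L \mid ax\le y\}$. An element $x\in L$ is principal if it satisfies both $y\wedge zx=((y:x)\wedge z)x$ and $y\vee(z:x)=((yx\vee z):x)$ for all $y,z\in L$. $L$ is principally generated if every element is a join of principal elements; $L$ is a $C$-lattice if $1$ is compact, the set of compact elements is closed under multiplication, and every element is a join of compact elements. Throughout, "lattice" means a multiplicative lattice which is a principally generated $C$-lattice. An element $p\in L\setminus\{1\}$ is prime if $xy\le p$ (with $x,y\in L$) implies $x\le p$ or $y\le p$. A lattice domain is a lattice in which $0$ is a prime element. Divisorial closure: for a lattice domain $L$ and $a\in L\setminus\{0\}$, $a_v:=(x:(x:a))$ for some nonzero principal element $x\le a$ (the result does not depend on the choice of $x$). The element $a$ is divisorial if $a=a_v$; also $0$ is declared divisorial. A lattice domain $L$ is divisorial if all its elements are divisorial. A lattice domain $L$ is completely integrally closed if $(xc:c)=x$ for each nonzero principal element $x$ and each nonzero element $c$ of $L$. A lattice domain is Dedekind (a Dedekind lattice) if all its elements are principal. *)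

theory Defs
  imports Main
begin

(* The bottom element 0 of the lattice is bot; the top element is both top and the
   monoid identity 1. The family in Sup_distrib may be empty, so x * bot = bot. *)
class multiplicative_lattice = complete_lattice + comm_monoid_mult +
  assumes one_eq_top: "1 = top"
    and Sup_distrib: "x * Sup B = Sup ((\<lambda>b. x * b) ` B)"

context multiplicative_lattice
begin

definition compact_elem :: "'a \<Rightarrow> bool" where
  "compact_elem c \<longleftrightarrow> (\<forall>S. c \<le> Sup S \<longrightarrow> (\<exists>T. finite T \<and> T \<subseteq> S \<and> c \<le> Sup T))"

(* residual y x is (y : x) *)
definition residual :: "'a \<Rightarrow> 'a \<Rightarrow> 'a" where
  "residual y x = Sup {a. a * x \<le> y}"

definition principal_elem :: "'a \<Rightarrow> bool" where
  "principal_elem x \<longleftrightarrow>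
     (\<forall>y z. inf y (z * x) = inf (residual y x) z * x \<and>
            sup y (residual z x) = residual (sup (y * x) z) x)"

definition prime_elem :: "'a \<Rightarrow> bool" where
  "prime_elem p \<longleftrightarrow> p \<noteq> 1 \<and> (\<forall>x y. x * y \<le> p \<longrightarrow> x \<le> p \<or> y \<le> p)"

end

class principally_generated_C_lattice = multiplicative_lattice +
  assumes principally_generated: "\<exists>S. (\<forall>s\<in>S. principal_elem s) \<and> x = Sup S"
    and compact_one: "compact_elem 1"
    and compact_mult: "compact_elem c \<Longrightarrow> compact_elem d \<Longrightarrow> compact_elem (c * d)"
    and compactly_generated: "\<exists>S. (\<forall>s\<in>S. compact_elem s) \<and> x = Sup S"

class lattice_domain = principally_generated_C_lattice +
  assumes prime_bot: "prime_elem bot"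

(* Only meaningful for a \<noteq> bot; the value is then independent of the chosen x, and a
   suitable x exists because a is a join of principal elements. *)
definition v_closure :: "'a::lattice_domain \<Rightarrow> 'a" where
  "v_closure a =
     (let x = (SOME x. principal_elem x \<and> x \<noteq> bot \<and> x \<le> a) in residual x (residual x a))"

definition divisorial_elem :: "'a::lattice_domain \<Rightarrow> bool" where
  "divisorial_elem a \<longleftrightarrow> a = bot \<or> a = v_closure a"

(* Properties of the whole lattice L, which is the universe of the type 'a. *)

definition divisorial :: "'a::lattice_domain itself \<Rightarrow> bool" where
  "divisorial L \<longleftrightarrow> (\<forall>a::'a. divisorial_elem a)"

definition completely_integrally_closed :: "'a::lattice_domain itself \<Rightarrow> bool" where
  "completely_integrally_closed L \<longleftrightarrow>
     (\<forall>x c::'a. principal_elem x \<and> x \<noteq> bot \<and> c \<noteq> bot \<longrightarrow> residual (x * c) c = x)"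

definition dedekind :: "'a::lattice_domain itself \<Rightarrow> bool" where
  "dedekind L \<longleftrightarrow> (\<forall>a::'a. principal_elem a)"

end

theory Submission
  imports Defs
begin

text \<open>
  In a lattice domain a nonzero principal element behaves like an invertible ideal: it can be
  cancelled in inequalities, it divides everything below it, and its factors are principal again
  (\<open>principal_factor\<close>).

  In a Dedekind lattice, a nonzero principal \<open>x \<le> a\<close> therefore factors as \<open>x = b * a\<close> with
  \<open>b = (x : a)\<close>, so that \<open>(x : b) = (b * a : b) = a\<close> by cancellation, that is, \<open>a\<close> is divisorial.

  For the converse, let \<open>a \<noteq> 0\<close>, choose a nonzero principal \<open>x \<le> a\<close> and put \<open>b = (x : a)\<close>.
  Then \<open>b\<close> plays the part of \<open>x * a\<^sup>-\<^sup>1\<close>, and \<open>a\<close> is a factor of a principal element as soon as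
  \<open>a * b = x\<close>. In terms of fractional ideals, complete integral closure makes the inverse of
  \<open>a * a\<^sup>-\<^sup>1\<close> trivial: an element multiplying \<open>a * a\<^sup>-\<^sup>1\<close> into the base ring multiplies \<open>a\<^sup>-\<^sup>1\<close>
  into itself. Hence the divisorial closure of \<open>a * b\<close> is \<open>x\<close>
  (\<open>v_closure_times_residual\<close>), and divisoriality of the single element \<open>a * b\<close> gives
  \<open>a * b = x\<close>. There are no fractions in \<open>L\<close>; they are avoided by working below a principal
  \<open>y = k * x\<close>, which clears the denominators.
\<close>

section \<open>Residuation\<close>

context multiplicative_lattice
begin

lemma mult_sup_distrib: "x * sup y z = sup (x * y) (x * z)"
  using Sup_distrib[of x "{y, z}"] by simp

lemma mult_le_mult_left: "y \<le> z \<Longrightarrow> x * y \<le> x * z"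
  by (metis mult_sup_distrib sup.absorb_iff2)

lemma mult_bot: "x * bot = bot"
  using Sup_distrib[of x "{}"] by simp

lemma mult_le_right: "a * x \<le> x"
  by (metis mult_le_mult_left one_eq_top top_greatest mult.commute mult_1_right)

lemma residual_mult_le: "residual y x * x \<le> y"
proof -
  have "x * residual y x = Sup ((\<lambda>a. x * a) ` {a. a * x \<le> y})"
    unfolding residual_def by (rule Sup_distrib)
  also have "\<dots> \<le> y"
    by (rule Sup_least) (auto simp: mult.commute)
  finally show ?thesis
    by (simp add: mult.commute)
qed

lemma le_residual_iff: "a \<le> residual y x \<longleftrightarrow> a * x \<le> y"
proof
  assume "a \<le> residual y x"
  then have "a * x \<le> residual y x * x"
    by (metis mult_le_mult_left mult.commute)
  then show "a * x \<le> y"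
    using residual_mult_le order.trans by blast
next
  assume "a * x \<le> y"
  then show "a \<le> residual y x"
    unfolding residual_def by (simp add: Sup_upper)
qed

lemma principal_elem_bot: "principal_elem bot"
proof -
  have "residual z bot = top" for z
    by (rule top_le) (simp add: le_residual_iff mult_bot)
  then show ?thesis
    by (simp add: principal_elem_def mult_bot)
qed

text \<open>This is the meet identity of a principal element at \<open>z = 1\<close>.\<close>

lemma principal_divides:
  assumes "principal_elem x" "w \<le> x"
  shows "residual w x * x = w"
proof -
  have "inf w (1 * x) = inf (residual w x) 1 * x"
    using assms(1) unfolding principal_elem_def by blast
  with assms(2) show ?thesis
    by (simp add: one_eq_top inf.absorb1)
      (metis inf.absorb1 mult_1_left one_eq_top)
qed

end

section \<open>Principal elements in a domain\<close>

context lattice_domain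
begin

lemma mult_neq_bot:
  assumes "x \<noteq> bot" "y \<noteq> bot"
  shows "x * y \<noteq> bot"
  using assms prime_bot unfolding prime_elem_def
  by (metis bot.extremum_uniqueI order_refl)

lemma nonzero_principal_below:
  assumes "a \<noteq> bot"
  obtains x where "principal_elem x" "x \<noteq> bot" "x \<le> a"
proof -
  obtain S where S: "\<forall>s\<in>S. principal_elem s" "a = Sup S"
    using principally_generated by blast
  with assms obtain s where "s \<in> S" "s \<noteq> bot"
    by (metis Sup_least bot.extremum_uniqueI order_refl)
  with S show thesis
    using that Sup_upper by metis
qed

text \<open>The join identity with \<open>z = 0\<close> reads \<open>d \<or> (0 : x) = (d * x : x)\<close>, and \<open>(0 : x) = 0\<close> because
  \<open>0\<close> is prime.\<close>

lemma principal_cancel: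
  assumes "principal_elem x" "x \<noteq> bot"
  shows "c * x \<le> d * x \<longleftrightarrow> c \<le> d"
proof
  assume "c * x \<le> d * x"
  have "residual bot x = bot"
    using residual_mult_le[of bot x] assms(2) mult_neq_bot
    by (metis bot.extremum_uniqueI)
  moreover have "sup d (residual bot x) = residual (sup (d * x) bot) x"
    using assms(1) unfolding principal_elem_def by blast
  ultimately have "residual (d * x) x = d"
    by simp
  then show "c \<le> d"
    using \<open>c * x \<le> d * x\<close> le_residual_iff by metis
next
  assume "c \<le> d"
  then show "c * x \<le> d * x"
    by (metis mult_le_mult_left mult.commute)
qed

lemma factor_cancel:
  assumes "principal_elem (k * x)" "k * x \<noteq> bot"
  shows "c * k \<le> d * k \<longleftrightarrow> c \<le> d"
proof
  assume "c * k \<le> d * k"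
  then have "x * (c * k) \<le> x * (d * k)"
    by (rule mult_le_mult_left)
  then have "c * (k * x) \<le> d * (k * x)"
    by (simp add: ac_simps)
  then show "c \<le> d"
    by (simp only: principal_cancel[OF assms])
next
  assume "c \<le> d"
  then show "c * k \<le> d * k"
    by (metis mult_le_mult_left mult.commute)
qed

text \<open>Both identities for \<open>k\<close> follow from those for \<open>k * x\<close>: multiply by \<open>x\<close>, use that \<open>k * x\<close> is
  principal, and cancel \<open>x\<close> or \<open>k\<close> again.\<close>

lemma principal_factor:
  assumes princ: "principal_elem (k * x)" and nz: "k * x \<noteq> bot"
  shows "principal_elem k"
  unfolding principal_elem_def
proof (intro allI conjI)
  have cancel_x: "c * x \<le> d * x \<longleftrightarrow> c \<le> d" for c d
    using factor_cancel[of x k] princ nz by (simp add: mult.commute)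
  fix c z
  show "inf c (z * k) = inf (residual c k) z * k"
  proof (rule order.antisym)
    define d where "d = inf c (z * k)"
    define u where "u = residual (d * x) (k * x)"
    have "d \<le> k"
      unfolding d_def using mult_le_right by (meson inf.cobounded2 order.trans)
    then have "u * (k * x) = d * x"
      unfolding u_def by (intro principal_divides princ) (simp add: cancel_x)
    then have d: "d = u * k"
      using cancel_x by (metis mult.assoc order.antisym order_refl)
    have "u * k \<le> z * k" "u * k \<le> c"
      using d unfolding d_def by (metis inf.cobounded2, metis inf.cobounded1)
    then have "u \<le> inf (residual c k) z"
      using factor_cancel[OF princ nz] by (simp add: le_residual_iff)
    then show "inf c (z * k) \<le> inf (residual c k) z * k"
      using d factor_cancel[OF princ nz] unfolding d_def by simp
    show "inf (residual c k) z * k \<le> inf c (z * k)"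
    proof (rule inf.boundedI)
      show "inf (residual c k) z * k \<le> c"
        using le_residual_iff inf.cobounded1 by blast
      show "inf (residual c k) z * k \<le> z * k"
        using factor_cancel[OF princ nz] by simp
    qed
  qed
  show "sup c (residual z k) = residual (sup (c * k) z) k"
  proof (rule order.antisym)
    have "residual z k * k \<le> sup (c * k) z"
      using residual_mult_le by (rule le_supI2)
    then show "sup c (residual z k) \<le> residual (sup (c * k) z) k"
      by (intro sup_least) (simp_all add: le_residual_iff)
    define w where "w = residual (sup (c * k) z) k"
    have "w * k \<le> sup (c * k) z"
      unfolding w_def by (rule residual_mult_le)
    then have "(w * k) * x \<le> sup (c * k) z * x"
      by (simp add: cancel_x)
    then have "w * (k * x) \<le> sup (c * (k * x)) (z * x)"
      using mult_sup_distrib[of x "c * k" z] by (simp add: ac_simps)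
    then have "w \<le> residual (sup (c * (k * x)) (z * x)) (k * x)"
      by (simp add: le_residual_iff)
    also have "\<dots> = sup c (residual (z * x) (k * x))"
      using princ unfolding principal_elem_def by simp
    also have "residual (z * x) (k * x) = residual z k"
      using cancel_x
      by (intro order.antisym)
        (metis le_residual_iff mult.assoc order_refl)+
    finally show "residual (sup (c * k) z) k \<le> sup c (residual z k)"
      unfolding w_def .
  qed
qed

text \<open>Whatever multiplies \<open>a\<close> into \<open>k * x\<close> is already a multiple of \<open>k\<close>, because \<open>x \<le> a\<close>.
  This is \<open>k * x * a\<^sup>-\<^sup>1 = k * (x * a\<^sup>-\<^sup>1)\<close> without fractions.\<close>

lemma residual_mult_principal:
  assumes k: "principal_elem k" "k \<noteq> bot"
    and x: "principal_elem x" "x \<noteq> bot" and "x \<le> a"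
  shows "residual (k * x) a = k * residual x a"
proof (rule order.antisym)
  define w where "w = residual (k * x) a"
  have w: "w * a \<le> k * x"
    unfolding w_def by (rule residual_mult_le)
  then have "w * x \<le> k * x"
    using mult_le_mult_left[OF \<open>x \<le> a\<close>] order.trans by blast
  then have "w \<le> k"
    using principal_cancel[OF x] by simp
  define u where "u = residual w k"
  have u: "u * k = w"
    unfolding u_def using principal_divides[OF k(1) \<open>w \<le> k\<close>] .
  have "(u * a) * k \<le> x * k"
    using w u by (simp add: ac_simps)
  then have "u \<le> residual x a"
    using principal_cancel[OF k] by (simp add: le_residual_iff)
  then show "residual (k * x) a \<le> k * residual x a"
    using u mult_le_mult_left unfolding w_def by (metis mult.commute)
  show "k * residual x a \<le> residual (k * x) a"
    using mult_le_mult_left[OF residual_mult_le[of x a], of k]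
    by (simp add: le_residual_iff mult.assoc)
qed

end

section \<open>Divisorial closure\<close>

lemma v_closure_cases:
  fixes a :: "'a::lattice_domain"
  assumes "a \<noteq> bot"
  obtains x where "principal_elem x" "x \<noteq> bot" "x \<le> a"
    "v_closure a = residual x (residual x a)"
proof -
  let ?P = "\<lambda>x. principal_elem x \<and> x \<noteq> bot \<and> x \<le> a"
  have "\<exists>x. ?P x"
    using nonzero_principal_below[OF assms] by metis
  then have "?P (SOME x. ?P x)"
    by (rule someI_ex)
  moreover have "v_closure a = residual (SOME x. ?P x) (residual (SOME x. ?P x) a)"
    by (simp add: v_closure_def Let_def)
  ultimately show thesis
    using that by blast
qed

lemma residual_mult_cancel:
  fixes k x :: "'a::lattice_domain"
  assumes "principal_elem k" "k \<noteq> bot"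
  shows "residual (x * k) k = x"
proof (rule order.antisym)
  show "residual (x * k) k \<le> x"
    using residual_mult_le[of "x * k" k] by (simp only: principal_cancel[OF assms])
  show "x \<le> residual (x * k) k"
    by (simp add: le_residual_iff)
qed

lemma principal_imp_divisorial:
  fixes a :: "'a::lattice_domain"
  assumes all_principal: "\<And>c::'a. principal_elem c"
  shows "divisorial_elem a"
proof (cases "a = bot")
  case False
  then obtain x where x: "x \<noteq> bot" "x \<le> a" "v_closure a = residual x (residual x a)"
    using v_closure_cases by metis
  define b where "b = residual x a"
  have ab: "a * b = x"
    unfolding b_def using principal_divides[OF all_principal \<open>x \<le> a\<close>] by (simp add: mult.commute)
  then have "b \<noteq> bot"
    using \<open>x \<noteq> bot\<close> mult_bot by metis
  then have "residual x b = a"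
    using residual_mult_cancel[OF all_principal, of b a] ab by simp
  then show ?thesis
    using x(3) unfolding b_def divisorial_elem_def by simp
qed (simp add: divisorial_elem_def)

text \<open>If \<open>z * (a * b) \<le> k * x\<close>, then \<open>z * b \<le> (k * x : a) = k * b\<close>, and complete integral closure
  cancels \<open>b\<close>. Thus \<open>(k * x : a * b) = k\<close>, whose residual in \<open>k * x\<close> is \<open>x\<close>.\<close>

lemma v_closure_times_residual:
  fixes a x :: "'a::lattice_domain"
  assumes cic: "completely_integrally_closed TYPE('a)"
    and x: "principal_elem x" "x \<noteq> bot" "x \<le> a"
  shows "a * residual x a \<noteq> bot" "v_closure (a * residual x a) = x"
proof -
  define b where "b = residual x a"
  have "x \<le> b"
    unfolding b_def by (simp add: le_residual_iff mult.commute[of x a] mult_le_right)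
  then have "a \<noteq> bot" "b \<noteq> bot"
    using x by (metis bot.extremum_uniqueI)+
  then have ab: "a * b \<noteq> bot"
    by (rule mult_neq_bot)
  then show "a * residual x a \<noteq> bot"
    unfolding b_def .
  obtain y where y: "principal_elem y" "y \<noteq> bot" "y \<le> a * b"
    and closure: "v_closure (a * b) = residual y (residual y (a * b))"
    using v_closure_cases[OF ab] by metis
  have abx: "a * b \<le> x"
    unfolding b_def using residual_mult_le[of x a] by (simp add: mult.commute)
  define k where "k = residual y x"
  have kx: "k * x = y"
    unfolding k_def using principal_divides[OF x(1)] y(3) abx order.trans by blast
  have k: "principal_elem k" "k \<noteq> bot"
    using principal_factor[of k x] kx y mult_bot[of x] by (auto simp: mult.commute)
  have "residual y (a * b) = k"
  proof (rule order.antisym)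
    define z where "z = residual y (a * b)"
    have "z * (a * b) \<le> k * x"
      unfolding z_def kx by (rule residual_mult_le)
    then have "z * b \<le> residual (k * x) a"
      by (simp add: le_residual_iff ac_simps)
    also have "\<dots> = k * b"
      unfolding b_def using residual_mult_principal k x by blast
    finally have "z \<le> residual (k * b) b"
      by (simp add: le_residual_iff)
    then show "residual y (a * b) \<le> k"
      using cic k \<open>b \<noteq> bot\<close> unfolding completely_integrally_closed_def z_def by metis
    show "k \<le> residual y (a * b)"
      using mult_le_mult_left[OF abx, of k] kx by (simp add: le_residual_iff)
  qed
  then have "v_closure (a * b) = residual (x * k) k"
    using closure kx by (simp add: mult.commute)
  then show "v_closure (a * residual x a) = x"
    using residual_mult_cancel[OF k] unfolding b_def by simp
qed

theorem theorem18:
  assumes "completely_integrally_closed TYPE('a::lattice_domain)"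
  shows "divisorial TYPE('a) \<longleftrightarrow> dedekind TYPE('a)"
proof
  assume div: "divisorial TYPE('a)"
  have "principal_elem a" for a :: 'a
  proof (cases "a = bot")
    case False
    then obtain x where x: "principal_elem x" "x \<noteq> bot" "x \<le> a"
      by (rule nonzero_principal_below)
    have "a * residual x a = x"
      using v_closure_times_residual[OF assms x] div
      unfolding divisorial_def divisorial_elem_def by metis
    then show ?thesis
      using principal_factor[of a "residual x a"] x by simp
  qed (simp add: principal_elem_bot)
  then show "dedekind TYPE('a)"
    by (simp add: dedekind_def)
next
  assume "dedekind TYPE('a)"
  then show "divisorial TYPE('a)"
    unfolding dedekind_def divisorial_def using principal_imp_divisorial by blast
qed

end
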